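(* Let $0<\alpha\le 1$, $1<\beta\le 2$, $p>0$, $q>0$, and let $\Omega=\{(x,t): 0<x<1,\ -p<t<q\}$, $\Omega^+=\Omega\cap\{t>0\}$, $\Omega^-=\Omega\cap\{t<0\}$. Suppose that $$\Delta_0:=p+\frac{p^\beta}{\Gamma(\beta+1)}-\frac{q^\alpha}{\Gamma(\alpha+1)}= 0 .$$ Then for every constant $f_0\neq 0$ the pair $u(x,t)=u_0(t)$, $f(x)=f_0$, where $$u_0(t)=\begin{cases}\dfrac{t^\alpha-q^\alpha}{\Gamma(\alpha+1)}\,f_0, & t\ge 0,\\[2mm] \left[\dfrac{(-t)^\beta-p^\beta}{\Gamma(\beta+1)}-t-p\right]f_0, & t\le 0,\end{cases}$$ is a nontrivial solution of the following problem: (i) $u\in C(\overline{\Omega})$, $u_{xx}\in C^2(\Omega^+\cup\Omega^-)$, ${}_CD_{0t}^\alpha u\in C(\Omega^+)$, ${}_CD_{t0}^\beta u\in C(\Omega^-)$, $f\in C(0,1)$; (ii) ${}_CD_{0t}^\alpha u(x,t)-u_{xx}(x,t)=f(x)$ in $\Omega^+$ and ${}_CD_{t0}^\beta u(x,t)-u_{xx}(x,t)=f(x)$ in $\Omega^-$; (iii) $u(0,t)=u(1,t)$ and $u_x(0,t)=0$ for $-p\le t\le q$; $u(x,-p)=0$ and $u(x,q)=0$ for $0\le x\le 1$; (iv) $\displaystyle\lim_{t\to+0}{}_CD_{0t}^\alpha u(x,t)=\lim_{t\to-0}\frac{\partial u(x,t)}{\partial(-t)}$ for $0<x<1$.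
   Context: The Caputo fractional operators act in the variable $t$ (with $x$ as a parameter). For $t>0$, $${}_CD_{0t}^{\alpha}g(t)=\frac{1}{\Gamma(1-\alpha)}\int_0^t\frac{g'(z)}{(t-z)^{\alpha}}\,dz\quad(0<\alpha<1),\qquad {}_CD_{0t}^{1}g=\frac{dg}{dt}.$$ For $t<0$, $${}_CD_{t0}^{\beta}g(t)=\frac{1}{\Gamma(2-\beta)}\int_t^0\frac{g''(z)}{(z-t)^{\beta-1}}\,dz\quad(1<\beta<2),\qquad {}_CD_{t0}^{2}g=\frac{d^2g}{dt^2}.$$ Here $\partial/\partial(-t)=-\partial/\partial t$. "Nontrivial" means that $(u,f)$ is not identically $(0,0)$. *)

theory Defs
  imports "HOL-Analysis.Analysis"
begin

definition twice_differentiable_at :: "(real \<Rightarrow> real) \<Rightarrow> real \<Rightarrow> bool" where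
  "twice_differentiable_at g x \<longleftrightarrow>
     (\<forall>\<^sub>F y in nhds x. g differentiable (at y)) \<and> deriv g differentiable (at x)"

text \<open>
  Both Caputo operators are total functions in the logic. The predicates
  \<open>caputo_pos_exists\<close> and \<open>caputo_neg_exists\<close> say when the defining formulas make sense: the
  derivatives exist on the interval of integration and the integral converges absolutely.
\<close>

definition caputo_pos_exists :: "real \<Rightarrow> (real \<Rightarrow> real) \<Rightarrow> real \<Rightarrow> bool" where
  "caputo_pos_exists \<alpha> g t \<longleftrightarrow>
     (if \<alpha> = 1 then g differentiable (at t)
      else (\<forall>z\<in>{0<..<t}. g differentiable (at z)) \<and>
           set_integrable lborel {0<..<t} (\<lambda>z. deriv g z / (t - z) powr \<alpha>))"

definition caputo_pos :: "real \<Rightarrow> (real \<Rightarrow> real) \<Rightarrow> real \<Rightarrow> real" where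
  "caputo_pos \<alpha> g t =
     (if \<alpha> = 1 then deriv g t
      else 1 / Gamma (1 - \<alpha>) * (LBINT z:{0<..<t}. deriv g z / (t - z) powr \<alpha>))"

definition caputo_neg_exists :: "real \<Rightarrow> (real \<Rightarrow> real) \<Rightarrow> real \<Rightarrow> bool" where
  "caputo_neg_exists \<beta> g t \<longleftrightarrow>
     (if \<beta> = 2 then twice_differentiable_at g t
      else (\<forall>z\<in>{t<..<0}. twice_differentiable_at g z) \<and>
           set_integrable lborel {t<..<0} (\<lambda>z. deriv (deriv g) z / (z - t) powr (\<beta> - 1)))"

definition caputo_neg :: "real \<Rightarrow> (real \<Rightarrow> real) \<Rightarrow> real \<Rightarrow> real" where
  "caputo_neg \<beta> g t =
     (if \<beta> = 2 then deriv (deriv g) t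
      else 1 / Gamma (2 - \<beta>) *
             (LBINT z:{t<..<0}. deriv (deriv g) z / (z - t) powr (\<beta> - 1)))"

text \<open>
  \<open>C_class k w S\<close>: all partial derivatives of \<open>w\<close> of order at most \<open>k\<close> exist and are
  continuous on the open planar set \<open>S\<close>.
\<close>

primrec C_class :: "nat \<Rightarrow> (real \<Rightarrow> real \<Rightarrow> real) \<Rightarrow> (real \<times> real) set \<Rightarrow> bool" where
  "C_class 0 w S \<longleftrightarrow> continuous_on S (\<lambda>(x, t). w x t)"
| "C_class (Suc k) w S \<longleftrightarrow>
     continuous_on S (\<lambda>(x, t). w x t) \<and>
     (\<forall>(x, t)\<in>S. (\<lambda>y. w y t) differentiable (at x) \<and> w x differentiable (at t)) \<and>
     C_class k (\<lambda>x t. deriv (\<lambda>y. w y t) x) S \<and>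
     C_class k (\<lambda>x t. deriv (w x) t) S"

definition u_xx :: "(real \<Rightarrow> real \<Rightarrow> real) \<Rightarrow> real \<Rightarrow> real \<Rightarrow> real" where
  "u_xx u x t = deriv (deriv (\<lambda>y. u y t)) x"

definition Omega :: "real \<Rightarrow> real \<Rightarrow> (real \<times> real) set" where
  "Omega p q = {(x, t). 0 < x \<and> x < 1 \<and> - p < t \<and> t < q}"

definition Omega_plus :: "real \<Rightarrow> real \<Rightarrow> (real \<times> real) set" where
  "Omega_plus p q = Omega p q \<inter> {(x, t). 0 < t}"

definition Omega_minus :: "real \<Rightarrow> real \<Rightarrow> (real \<times> real) set" where
  "Omega_minus p q = Omega p q \<inter> {(x, t). t < 0}"

definition cond_regularity ::
  "real \<Rightarrow> real \<Rightarrow> real \<Rightarrow> real \<Rightarrow> (real \<Rightarrow> real \<Rightarrow> real) \<Rightarrow> (real \<Rightarrow> real) \<Rightarrow> bool" where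
  "cond_regularity \<alpha> \<beta> p q u f \<longleftrightarrow>
     continuous_on (closure (Omega p q)) (\<lambda>(x, t). u x t) \<and>
     (\<forall>(x, t)\<in>Omega_plus p q \<union> Omega_minus p q. twice_differentiable_at (\<lambda>y. u y t) x) \<and>
     C_class 2 (u_xx u) (Omega_plus p q \<union> Omega_minus p q) \<and>
     (\<forall>(x, t)\<in>Omega_plus p q. caputo_pos_exists \<alpha> (u x) t) \<and>
     continuous_on (Omega_plus p q) (\<lambda>(x, t). caputo_pos \<alpha> (u x) t) \<and>
     (\<forall>(x, t)\<in>Omega_minus p q. caputo_neg_exists \<beta> (u x) t) \<and>
     continuous_on (Omega_minus p q) (\<lambda>(x, t). caputo_neg \<beta> (u x) t) \<and>
     continuous_on {0<..<1} f"

definition cond_equation ::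
  "real \<Rightarrow> real \<Rightarrow> real \<Rightarrow> real \<Rightarrow> (real \<Rightarrow> real \<Rightarrow> real) \<Rightarrow> (real \<Rightarrow> real) \<Rightarrow> bool" where
  "cond_equation \<alpha> \<beta> p q u f \<longleftrightarrow>
     (\<forall>(x, t)\<in>Omega_plus p q. caputo_pos \<alpha> (u x) t - u_xx u x t = f x) \<and>
     (\<forall>(x, t)\<in>Omega_minus p q. caputo_neg \<beta> (u x) t - u_xx u x t = f x)"

text \<open>On the boundary \<open>x = 0\<close> the derivative in \<open>x\<close> is the one-sided one.\<close>

definition cond_boundary :: "real \<Rightarrow> real \<Rightarrow> (real \<Rightarrow> real \<Rightarrow> real) \<Rightarrow> bool" where
  "cond_boundary p q u \<longleftrightarrow>
     (\<forall>t\<in>{-p..q}. u 0 t = u 1 t \<and>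
        ((\<lambda>x. u x t) has_real_derivative 0) (at 0 within {0..1})) \<and>
     (\<forall>x\<in>{0..1}. u x (- p) = 0 \<and> u x q = 0)"

text \<open>The gluing condition includes that both one-sided limits exist (as finite limits).\<close>

definition cond_gluing :: "real \<Rightarrow> real \<Rightarrow> (real \<Rightarrow> real \<Rightarrow> real) \<Rightarrow> bool" where
  "cond_gluing \<alpha> p u \<longleftrightarrow>
     (\<forall>x\<in>{0<..<1}.
        (\<forall>t\<in>{-p<..<0}. u x differentiable (at t)) \<and>
        (\<exists>L. ((\<lambda>t. caputo_pos \<alpha> (u x) t) \<longlongrightarrow> L) (at_right 0) \<and>
             ((\<lambda>t. - deriv (u x) t) \<longlongrightarrow> L) (at_left 0)))"

definition is_solution ::
  "real \<Rightarrow> real \<Rightarrow> real \<Rightarrow> real \<Rightarrow> (real \<Rightarrow> real \<Rightarrow> real) \<Rightarrow> (real \<Rightarrow> real) \<Rightarrow> bool" where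
  "is_solution \<alpha> \<beta> p q u f \<longleftrightarrow>
     cond_regularity \<alpha> \<beta> p q u f \<and> cond_equation \<alpha> \<beta> p q u f \<and>
     cond_boundary p q u \<and> cond_gluing \<alpha> p u"

definition nontrivial ::
  "real \<Rightarrow> real \<Rightarrow> (real \<Rightarrow> real \<Rightarrow> real) \<Rightarrow> (real \<Rightarrow> real) \<Rightarrow> bool" where
  "nontrivial p q u f \<longleftrightarrow>
     \<not> ((\<forall>(x, t)\<in>closure (Omega p q). u x t = 0) \<and> (\<forall>x\<in>{0<..<1}. f x = 0))"

definition Delta0 :: "real \<Rightarrow> real \<Rightarrow> real \<Rightarrow> real \<Rightarrow> real" where
  "Delta0 \<alpha> \<beta> p q = p + p powr \<beta> / Gamma (\<beta> + 1) - q powr \<alpha> / Gamma (\<alpha> + 1)"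

definition u0_pos :: "real \<Rightarrow> real \<Rightarrow> real \<Rightarrow> real \<Rightarrow> real" where
  "u0_pos \<alpha> q f0 t = (t powr \<alpha> - q powr \<alpha>) / Gamma (\<alpha> + 1) * f0"

definition u0_neg :: "real \<Rightarrow> real \<Rightarrow> real \<Rightarrow> real \<Rightarrow> real" where
  "u0_neg \<beta> p f0 t = (((- t) powr \<beta> - p powr \<beta>) / Gamma (\<beta> + 1) - t - p) * f0"

definition u0 :: "real \<Rightarrow> real \<Rightarrow> real \<Rightarrow> real \<Rightarrow> real \<Rightarrow> real \<Rightarrow> real" where
  "u0 \<alpha> \<beta> p q f0 t = (if t \<ge> 0 then u0_pos \<alpha> q f0 t else u0_neg \<beta> p f0 t)"

end

theory Submission
  imports Defs
begin

text \<open>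
  The pair is independent of \<open>x\<close>, so the equation reduces to the fact that both Caputo derivatives
  of \<open>u\<^sub>0\<close> are identically \<open>f\<^sub>0\<close>. For fractional orders this is Euler's Beta integral
  \<open>B(a, 1 - a) = \<Gamma>(a) \<Gamma>(1 - a)\<close> with \<open>a = \<alpha>\<close> and \<open>a = \<beta> - 1\<close>. The condition \<open>\<Delta>\<^sub>0 = 0\<close> says
  exactly that the two branches of \<open>u\<^sub>0\<close> agree at \<open>t = 0\<close>, and the linear term \<open>- t\<close> in the
  lower branch produces the slope \<open>- f\<^sub>0\<close> at \<open>t = -0\<close> required by the gluing condition.
\<close>

section \<open>The Beta integral on an arbitrary interval\<close>

lemma Gamma_plus1_pos: "Gamma (a + 1) = a * Gamma a" if "a > 0" for a :: real
  using that by (intro Gamma_plus1) (auto elim!: nonpos_Ints_cases)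

text \<open>The substitution \<open>z = t * s\<close> leads to the Beta integral with parameters
  \<open>a\<close> and \<open>1 - a\<close>. The integrand is homogeneous of degree -1 in
  \<open>z\<close> and \<open>t\<close> together, so the powers of \<open>t\<close> cancel against
  \<open>dz\<close>; the denominator of the Beta function is \<open>Gamma 1 = 1\<close>.\<close>

lemma has_bochner_integral_Abel_kernel:
  fixes a t :: real
  assumes "0 < a" "a < 1" "0 < t"
  shows "has_bochner_integral lborel
           (\<lambda>z. indicator {0<..<t} z * (z powr (a - 1) / (t - z) powr a)) (Gamma a * Gamma (1 - a))"
proof -
  let ?f = "\<lambda>s::real. s powr (a - 1) * (1 - s) powr (1 - a - 1)"
  have int: "set_integrable lborel {0..1} ?f"
    using assms by (intro integrable_Beta) auto
  have int': "set_integrable lborel {0<..<1} ?f"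
    by (rule set_integrable_subset[OF int]) auto
  have "(?f has_integral Beta a (1 - a)) {0<..<1}"
    using has_integral_Beta_real[of a "1 - a"] assms by (simp add: has_integral_Icc_iff_Ioo)
  then have "integral {0<..<1} ?f = Gamma a * Gamma (1 - a)"
    by (simp add: integral_unique Beta_def)
  with set_borel_integral_eq_integral(2)[OF int'] int'
  have "has_bochner_integral lborel (\<lambda>s. indicator {0<..<1} s * ?f s) (Gamma a * Gamma (1 - a))"
    by (simp add: has_bochner_integral_iff set_integrable_def set_lebesgue_integral_def)
  then have "has_bochner_integral lborel
      (\<lambda>z. indicator {0<..<1} (0 + (1 / t) * z) * ?f (0 + (1 / t) * z))
      ((Gamma a * Gamma (1 - a)) /\<^sub>R \<bar>1 / t\<bar>)"
    using assms by (subst (asm) lborel_has_bochner_integral_real_affine_iff[of "1 / t" _ _ 0]) auto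
  \<comment> \<open>The affine substitution has divided the value by the scale \<open>1 / t\<close>;
    this factor restores it.\<close>
  then have "has_bochner_integral lborel
      (\<lambda>z. (1 / t) * (indicator {0<..<1} (0 + (1 / t) * z) * ?f (0 + (1 / t) * z)))
      ((1 / t) * ((Gamma a * Gamma (1 - a)) /\<^sub>R \<bar>1 / t\<bar>))"
    by (intro has_bochner_integral_mult_right)
  moreover have "(1 / t) * (indicator {0<..<1} (0 + (1 / t) * z) * ?f (0 + (1 / t) * z)) =
      indicator {0<..<t} z * (z powr (a - 1) / (t - z) powr a)" for z
  proof (cases "0 < z \<and> z < t")
    case True
    have "1 - z / t = (t - z) / t"
      using assms by (simp add: field_simps)
    then have "?f (z / t) = (z powr (a - 1) / t powr (a - 1)) * ((t - z) powr (- a) / t powr (- a))"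
      using True by (simp add: powr_divide)
    \<comment> \<open>The exponents of \<open>t\<close> add up to
      \<open>(a - 1) + (- a) = - 1\<close>, which leaves a factor \<open>t\<close> to cancel the
      outer \<open>1 / t\<close>.\<close>
    also have "\<dots> = z powr (a - 1) * (t - z) powr (- a) / t powr (- 1)"
      using assms by (simp flip: powr_add)
    also have "\<dots> = t * (z powr (a - 1) / (t - z) powr a)"
      using assms by (simp add: powr_minus field_simps)
    finally show ?thesis
      using True assms by simp
  next
    case False
    then show ?thesis
      using assms by (auto simp: indicator_def field_simps)
  qed
  ultimately show ?thesis
    using assms by simp
qed

text \<open>Reflection \<open>z = - s\<close> carries the kernel on \<open>{0<..<-t}\<close> to this
  one; its scale has absolute value 1.\<close>

lemma has_bochner_integral_Abel_kernel_reflected: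
  fixes a t :: real
  assumes "0 < a" "a < 1" "t < 0"
  shows "has_bochner_integral lborel
           (\<lambda>z. indicator {t<..<0} z * ((- z) powr (a - 1) / (z - t) powr a)) (Gamma a * Gamma (1 - a))"
proof -
  have "has_bochner_integral lborel
      (\<lambda>z. indicator {0<..<-t} (0 + (-1) * z) *
             ((0 + (-1) * z) powr (a - 1) / (- t - (0 + (-1) * z)) powr a))
      ((Gamma a * Gamma (1 - a)) /\<^sub>R \<bar>-1\<bar>)"
    using has_bochner_integral_Abel_kernel[of a "- t"] assms
    by (subst lborel_has_bochner_integral_real_affine_iff[of "-1" _ _ 0, symmetric]) auto
  also have "(\<lambda>z. indicator {0<..<-t} (0 + (-1) * z) *
             ((0 + (-1) * z) powr (a - 1) / (- t - (0 + (-1) * z)) powr a)) =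
      (\<lambda>z. indicator {t<..<0} z * ((- z) powr (a - 1) / (z - t) powr a))"
    by (auto simp: fun_eq_iff indicator_def)
  finally show ?thesis
    by simp
qed

section \<open>Caputo derivatives of functions with power-law derivatives\<close>

lemma has_bochner_integral_imp_set_integral:
  fixes g h :: "real \<Rightarrow> real"
  assumes "has_bochner_integral lborel (\<lambda>z. indicator S z * h z) I"
    and "\<And>z. z \<in> S \<Longrightarrow> g z = c * h z"
  shows "set_integrable lborel S g" and "(LBINT z:S. g z) = c * I"
proof -
  have "has_bochner_integral lborel (\<lambda>z. c * (indicator S z * h z)) (c * I)"
    using assms(1) by (intro has_bochner_integral_mult_right)
  \<comment> \<open>Outside \<open>S\<close> the indicator annihilates both sides, so agreement on
    \<open>S\<close> is enough.\<close>
  also have "(\<lambda>z. c * (indicator S z * h z)) = (\<lambda>z. indicator S z *\<^sub>R g z)"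
    using assms(2) by (auto simp: fun_eq_iff indicator_def)
  finally show "set_integrable lborel S g" and "(LBINT z:S. g z) = c * I"
    by (simp_all add: has_bochner_integral_iff set_integrable_def set_lebesgue_integral_def)
qed

text \<open>The Beta integral with \<open>a = \<alpha>\<close> gives
  \<open>c * Gamma (1 - \<alpha>)\<close>, which the prefactor of the operator reduces to
  \<open>c\<close>. The derivative is prescribed only for \<open>z > 0\<close>, since the power may
  blow up at 0.\<close>

lemma caputo_pos_of_power_derivative:
  assumes "0 < \<alpha>" "\<alpha> \<le> 1" "0 < t"
    and deriv: "\<And>z. z > 0 \<Longrightarrow> (g has_real_derivative c * z powr (\<alpha> - 1) / Gamma \<alpha>) (at z)"
  shows "caputo_pos_exists \<alpha> g t" and "caputo_pos \<alpha> g t = c"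
proof -
  have diff: "g differentiable (at z)" and dg: "deriv g z = c * z powr (\<alpha> - 1) / Gamma \<alpha>"
    if "z > 0" for z
    using deriv[OF that] by (auto simp: real_differentiable_def intro: DERIV_imp_deriv)
  have "caputo_pos_exists \<alpha> g t \<and> caputo_pos \<alpha> g t = c"
  proof (cases "\<alpha> = 1")
    \<comment> \<open>In the classical case the power is \<open>t powr 0 = 1\<close>, and
      \<open>Gamma 1 = 1\<close>.\<close>
    case True
    then show ?thesis
      using diff dg assms by (simp add: caputo_pos_exists_def caputo_pos_def)
  next
    case False
    then have \<alpha>: "0 < \<alpha>" "\<alpha> < 1"
      using assms by auto
    have eq: "deriv g z / (t - z) powr \<alpha> = (c / Gamma \<alpha>) * (z powr (\<alpha> - 1) / (t - z) powr \<alpha>)"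
      if "z \<in> {0<..<t}" for z
      using that dg by simp
    note I = has_bochner_integral_imp_set_integral[OF
        has_bochner_integral_Abel_kernel[OF \<alpha> \<open>0 < t\<close>] eq]
    have "Gamma \<alpha> > 0" "Gamma (1 - \<alpha>) > 0"
      using \<alpha> by (auto intro!: Gamma_real_pos)
    then show ?thesis
      using False I diff by (simp add: caputo_pos_exists_def caputo_pos_def)
  qed
  then show "caputo_pos_exists \<alpha> g t" and "caputo_pos \<alpha> g t = c"
    by auto
qed

text \<open>Now the second derivative carries the power, so the reflected kernel is used with
  \<open>a = \<beta> - 1\<close>. The closed form \<open>g'\<close> is kept apart from
  \<open>deriv g\<close>, with which it agrees on the negative axis.\<close>

lemma caputo_neg_of_power_derivative:
  assumes "1 < \<beta>" "\<beta> \<le> 2" "t < 0"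
    and deriv1: "\<And>z. z < 0 \<Longrightarrow> (g has_real_derivative g' z) (at z)"
    and deriv2: "\<And>z. z < 0 \<Longrightarrow>
      (g' has_real_derivative c * (- z) powr (\<beta> - 2) / Gamma (\<beta> - 1)) (at z)"
  shows "caputo_neg_exists \<beta> g t" and "caputo_neg \<beta> g t = c"
proof -
  have ev: "\<forall>\<^sub>F y in nhds z. y < 0" if "z < 0" for z :: real
    using eventually_nhds_in_open[of "{..<0}" z] that by auto
  have dg2: "(deriv g has_real_derivative c * (- z) powr (\<beta> - 2) / Gamma (\<beta> - 1)) (at z)"
    if "z < 0" for z
  proof -
    \<comment> \<open>Agreement at \<open>z\<close> alone would not do: differentiating once more
      needs it on a neighbourhood.\<close>
    have "\<forall>\<^sub>F y in nhds z. deriv g y = g' y"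
      using ev[OF that] by eventually_elim (rule DERIV_imp_deriv[OF deriv1])
    then show ?thesis
      using deriv2[OF that] by (subst DERIV_cong_ev) auto
  qed
  then have dg: "deriv (deriv g) z = c * (- z) powr (\<beta> - 2) / Gamma (\<beta> - 1)" if "z < 0" for z
    using that by (intro DERIV_imp_deriv)
  have diff: "twice_differentiable_at g z" if "z < 0" for z
    unfolding twice_differentiable_at_def
  proof
    show "\<forall>\<^sub>F y in nhds z. g differentiable (at y)"
      using ev[OF that] by eventually_elim (use deriv1 in \<open>auto simp: real_differentiable_def\<close>)
    show "deriv g differentiable (at z)"
      using dg2[OF that] by (auto simp: real_differentiable_def)
  qed
  have "caputo_neg_exists \<beta> g t \<and> caputo_neg \<beta> g t = c"
  proof (cases "\<beta> = 2")
    case True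
    then show ?thesis
      using diff dg assms by (simp add: caputo_neg_exists_def caputo_neg_def)
  next
    case False
    then have \<beta>: "0 < \<beta> - 1" "\<beta> - 1 < 1"
      using assms by auto
    have eq: "deriv (deriv g) z / (z - t) powr (\<beta> - 1) =
        (c / Gamma (\<beta> - 1)) * ((- z) powr (\<beta> - 1 - 1) / (z - t) powr (\<beta> - 1))"
      if "z \<in> {t<..<0}" for z
      using that dg by simp
    note I = has_bochner_integral_imp_set_integral[OF
        has_bochner_integral_Abel_kernel_reflected[OF \<beta> \<open>t < 0\<close>] eq]
    have "Gamma (\<beta> - 1) > 0" "Gamma (2 - \<beta>) > 0"
      using \<beta> by (auto intro!: Gamma_real_pos)
    then show ?thesis
      using False I diff by (simp add: caputo_neg_exists_def caputo_neg_def)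
  qed
  then show "caputo_neg_exists \<beta> g t" and "caputo_neg \<beta> g t = c"
    by auto
qed

section \<open>Derivatives and continuity of \<open>u0\<close>\<close>

lemma u0_has_derivative_pos:
  assumes "0 < \<alpha>" "0 < t"
  shows "(u0 \<alpha> \<beta> p q f0 has_real_derivative f0 * t powr (\<alpha> - 1) / Gamma \<alpha>) (at t)"
proof -
  have "Gamma \<alpha> > 0"
    using assms by (intro Gamma_real_pos) auto
  then have Gamma_nz: "Gamma \<alpha> \<noteq> 0"
    by simp
  \<comment> \<open>Near \<open>t\<close> only one branch is active, so its closed form can be
    differentiated.\<close>
  have "\<forall>\<^sub>F y in nhds t. y > 0"
    using eventually_nhds_in_open[of "{0<..}" t] assms by auto
  then have "\<forall>\<^sub>F y in nhds t. u0 \<alpha> \<beta> p q f0 y = (y powr \<alpha> - q powr \<alpha>) / Gamma (\<alpha> + 1) * f0"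
    by eventually_elim (simp add: u0_def u0_pos_def)
  moreover have "((\<lambda>y. (y powr \<alpha> - q powr \<alpha>) / Gamma (\<alpha> + 1) * f0)
      has_real_derivative f0 * t powr (\<alpha> - 1) / Gamma \<alpha>) (at t)"
    using assms Gamma_nz by (auto intro!: derivative_eq_intros simp: Gamma_plus1_pos)
  ultimately show ?thesis
    by (subst DERIV_cong_ev) auto
qed

lemma u0_has_derivative_neg:
  assumes "1 < \<beta>" "t < 0"
  shows "(u0 \<alpha> \<beta> p q f0 has_real_derivative - ((- t) powr (\<beta> - 1) / Gamma \<beta> + 1) * f0) (at t)"
proof -
  have "Gamma \<beta> > 0"
    using assms by (intro Gamma_real_pos) auto
  then have Gamma_nz: "Gamma \<beta> \<noteq> 0"
    by simp
  have "\<forall>\<^sub>F y in nhds t. y < 0"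
    using eventually_nhds_in_open[of "{..<0}" t] assms by auto
  then have "\<forall>\<^sub>F y in nhds t. u0 \<alpha> \<beta> p q f0 y =
      (((- y) powr \<beta> - p powr \<beta>) / Gamma (\<beta> + 1) - y - p) * f0"
    by eventually_elim (simp add: u0_def u0_neg_def)
  moreover have "((\<lambda>y. (((- y) powr \<beta> - p powr \<beta>) / Gamma (\<beta> + 1) - y - p) * f0)
      has_real_derivative - ((- t) powr (\<beta> - 1) / Gamma \<beta> + 1) * f0) (at t)"
    using assms Gamma_nz by (auto intro!: derivative_eq_intros simp: Gamma_plus1_pos)
  ultimately show ?thesis
    by (subst DERIV_cong_ev) auto
qed

text \<open>The linear term of the lower branch survives in the first derivative only as a constant
  and disappears here: it sets the slope at 0 without affecting the Caputo derivative.\<close>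

lemma u0_has_second_derivative_neg:
  fixes t :: real
  assumes "1 < \<beta>" "t < 0"
  shows "((\<lambda>z. - ((- z) powr (\<beta> - 1) / Gamma \<beta> + 1) * f0)
           has_real_derivative f0 * (- t) powr (\<beta> - 2) / Gamma (\<beta> - 1)) (at t)"
proof -
  have "Gamma \<beta> > 0"
    using assms by (intro Gamma_real_pos) auto
  then have Gamma_nz: "Gamma \<beta> \<noteq> 0"
    by simp
  have "Gamma \<beta> = (\<beta> - 1) * Gamma (\<beta> - 1)"
    using Gamma_plus1_pos[of "\<beta> - 1"] assms by simp
  moreover have "Gamma (\<beta> - 1) > 0"
    using assms by (intro Gamma_real_pos) auto
  moreover have "((\<lambda>z. - ((- z) powr (\<beta> - 1) / Gamma \<beta> + 1) * f0)
      has_real_derivative (\<beta> - 1) * (- t) powr (\<beta> - 2) / Gamma \<beta> * f0) (at t)"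
    using assms Gamma_nz by (auto intro!: derivative_eq_intros)
  ultimately show ?thesis
    using assms by (simp add: mult_ac)
qed

text \<open>Only \<open>t = 0\<close> needs an argument, because \<open>u0\<close> takes the upper
  branch there. The powers of \<open>t\<close> vanish, and the remaining constants agree by
  \<open>Delta0\<close>.\<close>

lemma u0_eq_u0_neg:
  assumes "Delta0 \<alpha> \<beta> p q = 0" "t \<le> 0"
  shows "u0 \<alpha> \<beta> p q f0 t = u0_neg \<beta> p f0 t"
proof (cases "t = 0")
  case True
  have "q powr \<alpha> / Gamma (\<alpha> + 1) = p + p powr \<beta> / Gamma (\<beta> + 1)"
    using assms by (simp add: Delta0_def)
  then have "- (q powr \<alpha>) / Gamma (\<alpha> + 1) * f0 = (- (p powr \<beta>) / Gamma (\<beta> + 1) - p) * f0"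
    by simp
  with True show ?thesis
    by (simp add: u0_def u0_pos_def u0_neg_def)
qed (use assms in \<open>simp add: u0_def\<close>)

text \<open>The branches are pasted along closed half-lines meeting at 0; positive exponents keep
  the powers continuous where their base is 0.\<close>

lemma continuous_u0:
  assumes "0 < \<alpha>" "0 < \<beta>" "Delta0 \<alpha> \<beta> p q = 0"
  shows "continuous_on UNIV (u0 \<alpha> \<beta> p q f0)"
proof -
  have "continuous_on ({0..} \<union> {..0}) (\<lambda>t. if t \<ge> 0 then u0_pos \<alpha> q f0 t else u0_neg \<beta> p f0 t)"
  proof (rule continuous_on_If)
    show "continuous_on {0..} (u0_pos \<alpha> q f0)"
      unfolding u0_pos_def divide_inverse using assms
      by (intro continuous_intros continuous_on_powr') auto
    show "continuous_on {..0} (u0_neg \<beta> p f0)"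
      unfolding u0_neg_def divide_inverse using assms
      by (intro continuous_intros continuous_on_powr') auto
  qed (use u0_eq_u0_neg[OF assms(3), of 0 f0] in \<open>auto simp: u0_def\<close>)
  moreover have "{0..} \<union> {..0} = (UNIV :: real set)"
    by auto
  ultimately show ?thesis
    by (simp add: u0_def[abs_def])
qed

lemma u_xx_of_time_function: "u_xx (\<lambda>x t. g t) = (\<lambda>x t. 0)"
  by (simp add: u_xx_def fun_eq_iff)

section \<open>Verification of the conditions of the problem\<close>

theorem mainTheorem2:
  fixes \<alpha> \<beta> p q :: real
  assumes "0 < \<alpha>" "\<alpha> \<le> 1" "1 < \<beta>" "\<beta> \<le> 2" "p > 0" "q > 0"
    and "Delta0 \<alpha> \<beta> p q = 0"
  shows "\<forall>f0::real. f0 \<noteq> 0 \<longrightarrow>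
           (\<forall>t\<ge>0. u0 \<alpha> \<beta> p q f0 t = u0_pos \<alpha> q f0 t) \<and>
           (\<forall>t\<le>0. u0 \<alpha> \<beta> p q f0 t = u0_neg \<beta> p f0 t) \<and>
           is_solution \<alpha> \<beta> p q (\<lambda>x t. u0 \<alpha> \<beta> p q f0 t) (\<lambda>x. f0) \<and>
           nontrivial p q (\<lambda>x t. u0 \<alpha> \<beta> p q f0 t) (\<lambda>x. f0)"
proof (intro allI impI conjI)
  fix f0 :: real
  assume "f0 \<noteq> 0"
  let ?u = "u0 \<alpha> \<beta> p q f0"
  show "?u t = u0_pos \<alpha> q f0 t" if "t \<ge> 0" for t
    using that by (simp add: u0_def)
  show "?u t = u0_neg \<beta> p f0 t" if "t \<le> 0" for t
    using that assms(7) by (rule u0_eq_u0_neg[rotated])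
  show "nontrivial p q (\<lambda>x t. ?u t) (\<lambda>x. f0)"
    \<comment> \<open>Density supplies a point of the open unit interval, where \<open>f\<close>
      takes the value \<open>f0\<close>.\<close>
    unfolding nontrivial_def using \<open>f0 \<noteq> 0\<close> dense[of 0 "1 :: real"] by auto
  have pos: "caputo_pos_exists \<alpha> ?u t" "caputo_pos \<alpha> ?u t = f0" if "t > 0" for t
    using caputo_pos_of_power_derivative[OF assms(1,2) that u0_has_derivative_pos[OF assms(1)]]
    by blast+
  have neg: "caputo_neg_exists \<beta> ?u t" "caputo_neg \<beta> ?u t = f0" if "t < 0" for t
    using caputo_neg_of_power_derivative[OF assms(3,4) that
        u0_has_derivative_neg[OF assms(3)] u0_has_second_derivative_neg[OF assms(3)]]
    by blast+
  have "cond_regularity \<alpha> \<beta> p q (\<lambda>x t. ?u t) (\<lambda>x. f0)"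
    unfolding cond_regularity_def
  proof (intro conjI)
    have "continuous_on UNIV ?u"
      using assms by (intro continuous_u0) auto
    then show "continuous_on (closure (Omega p q)) (\<lambda>(x, t). ?u t)"
      unfolding case_prod_beta
      by (rule continuous_on_compose2) (auto intro: continuous_intros)
    show "continuous_on (Omega_plus p q) (\<lambda>(x, t). caputo_pos \<alpha> ?u t)"
      by (rule continuous_on_eq[OF continuous_on_const[of _ f0]]) (auto simp: Omega_plus_def pos)
    show "continuous_on (Omega_minus p q) (\<lambda>(x, t). caputo_neg \<beta> ?u t)"
      by (rule continuous_on_eq[OF continuous_on_const[of _ f0]]) (auto simp: Omega_minus_def neg)
    show "\<forall>(x, t)\<in>Omega_plus p q \<union> Omega_minus p q. twice_differentiable_at (\<lambda>y. ?u t) x"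
      by (auto simp: twice_differentiable_at_def)
    \<comment> \<open>Since \<open>u_xx\<close> is the zero function, every level of the recursion
      concerns constants only.\<close>
    show "C_class 2 (u_xx (\<lambda>x t. ?u t)) (Omega_plus p q \<union> Omega_minus p q)"
      by (simp add: u_xx_of_time_function numeral_2_eq_2 case_prod_beta)
  qed (auto simp: Omega_plus_def Omega_minus_def pos neg)
  moreover have "cond_equation \<alpha> \<beta> p q (\<lambda>x t. ?u t) (\<lambda>x. f0)"
    by (auto simp: cond_equation_def u_xx_of_time_function Omega_plus_def Omega_minus_def pos neg)
  moreover have "cond_boundary p q (\<lambda>x t. ?u t)"
    using assms by (auto simp: cond_boundary_def u0_def u0_pos_def u0_neg_def)
  moreover have "cond_gluing \<alpha> p (\<lambda>x t. ?u t)"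
    unfolding cond_gluing_def
  \<comment> \<open>The common limit is \<open>f0\<close>, for every \<open>x\<close>.\<close>
  proof (intro ballI conjI exI)
    show "?u differentiable (at t)" if "t \<in> {-p<..<0}" for t
      using u0_has_derivative_neg[OF assms(3), of t \<alpha> p q f0] that
      unfolding real_differentiable_def by auto
    show "((\<lambda>t. caputo_pos \<alpha> ?u t) \<longlongrightarrow> f0) (at_right 0)"
      by (rule tendsto_eventually) (auto simp: eventually_at_right_less pos
          intro: eventually_mono[OF eventually_at_right_less])
    \<comment> \<open>The limiting base is 0, so convergence relies on \<open>\<beta> > 1\<close>
      and on \<open>- t\<close> being nonnegative to the left of 0. The limit is 0, which leaves
      only the slope of the linear term.\<close>
    have "((\<lambda>t::real. (- t) powr (\<beta> - 1)) \<longlongrightarrow> (- 0) powr (\<beta> - 1)) (at_left 0)"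
      using assms by (intro tendsto_powr' tendsto_intros) (auto simp: eventually_at_filter)
    then have "((\<lambda>t::real. ((- t) powr (\<beta> - 1) * inverse (Gamma \<beta>) + 1) * f0)
        \<longlongrightarrow> (0 * inverse (Gamma \<beta>) + 1) * f0) (at_left 0)"
      by (intro tendsto_intros) simp
    moreover have "\<forall>\<^sub>F t in at_left 0.
        ((- t) powr (\<beta> - 1) * inverse (Gamma \<beta>) + 1) * f0 = - deriv ?u t"
      unfolding eventually_at_filter
      by (intro always_eventually allI impI)
        (simp add: DERIV_imp_deriv[OF u0_has_derivative_neg[OF assms(3)]] divide_inverse algebra_simps)
    ultimately show "((\<lambda>t. - deriv ?u t) \<longlongrightarrow> f0) (at_left 0)"
      by (auto dest: Lim_transform_eventually)
  qed
  ultimately show "is_solution \<alpha> \<beta> p q (\<lambda>x t. ?u t) (\<lambda>x. f0)"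
    by (simp add: is_solution_def)
qed

end
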